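(* Let $\mathbb{F}_q$ be a finite field of characteristic $p\ge 3$, and let $J_{\mathrm{D}}(q)$ be the number of distinct values of the $j$-invariant of the elliptic curves $\mathbf{E}_{\mathrm{D},u}: Y^2=X^3+uX^2+16uX$, as $u$ ranges over $\mathbb{F}_q\setminus\{0,64\}$. Then $$ J_{\mathrm{D}}(q)=\begin{cases} \dfrac{2q-3}{3} & \text{if } q\equiv 0\pmod 3,\\[4pt] \dfrac{2q+1}{3} & \text{if } q\equiv 1\pmod 3,\\[4pt] \dfrac{2q-1}{3} & \text{if } q\equiv 2\pmod 3. \end{cases}$$
   Context: The condition $u\ne 0,64$ ensures that $\mathbf{E}_{\mathrm{D},u}$ is nonsingular. Its $j$-invariant is $j(\mathbf{E}_{\mathrm{D},u})=\dfrac{(u-48)^3}{u-64}$. Equivalently, $J_{\mathrm{D}}(q)$ is the number of $\overline{\mathbb{F}}_q$-isomorphism classes of curves in the family. *)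

theory Defs
  imports Complex_Main "HOL-Library.Cardinality"
begin

(* The Weierstrass cubic  Y^2 + a1 X Y + a3 Y = X^3 + a2 X^2 + a4 X + a6. *)
datatype 'a weierstrass = Weierstrass (a1: 'a) (a2: 'a) (a3: 'a) (a4: 'a) (a6: 'a)

(* The standard invariants (Tate's formulaire), valid in every characteristic. *)
definition b2 :: "'a::field weierstrass \<Rightarrow> 'a" where
  "b2 E = a1 E ^ 2 + 4 * a2 E"

definition b4 :: "'a::field weierstrass \<Rightarrow> 'a" where
  "b4 E = 2 * a4 E + a1 E * a3 E"

definition b6 :: "'a::field weierstrass \<Rightarrow> 'a" where
  "b6 E = a3 E ^ 2 + 4 * a6 E"

definition b8 :: "'a::field weierstrass \<Rightarrow> 'a" where
  "b8 E = a1 E ^ 2 * a6 E + 4 * a2 E * a6 E - a1 E * a3 E * a4 E + a2 E * a3 E ^ 2 - a4 E ^ 2"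

definition c4 :: "'a::field weierstrass \<Rightarrow> 'a" where
  "c4 E = b2 E ^ 2 - 24 * b4 E"

definition discriminant :: "'a::field weierstrass \<Rightarrow> 'a" where
  "discriminant E = - (b2 E ^ 2 * b8 E) - 8 * b4 E ^ 3 - 27 * b6 E ^ 2 + 9 * b2 E * b4 E * b6 E"

(* Only meaningful for elliptic curves, i.e. when the discriminant is nonzero. *)
definition j_invariant :: "'a::field weierstrass \<Rightarrow> 'a" where
  "j_invariant E = c4 E ^ 3 / discriminant E"

(* Y^2 = X^3 + u X^2 + 16 u X *)
definition E_D :: "'a::field \<Rightarrow> 'a weierstrass" where
  "E_D u = Weierstrass 0 u 0 (16 * u) 0"

definition J_D :: "'a::{field,finite} itself \<Rightarrow> nat" where
  "J_D _ = card {j_invariant (E_D u) | u :: 'a. u \<noteq> 0 \<and> u \<noteq> 64}"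

lemma discriminant_E_D: "discriminant (E_D u) = 2 ^ 12 * u ^ 3 * (u - 64)"
  by (simp add: discriminant_def b2_def b4_def b6_def b8_def E_D_def
      power2_eq_square power3_eq_cube algebra_simps)

(* Away from characteristic 2, the excluded parameters are exactly the singular members,
   so j_invariant is only used where it is meaningful. *)
lemma E_D_nonsingular_iff:
  fixes u :: "'a::field"
  assumes "(2::'a) \<noteq> 0"
  shows "discriminant (E_D u) \<noteq> 0 \<longleftrightarrow> u \<noteq> 0 \<and> u \<noteq> 64"
proof -
  have "(2::'a) ^ 12 \<noteq> 0"
    using assms by (rule power_not_zero)
  then show ?thesis
    unfolding discriminant_E_D by (simp del: power_numeral)
qed

end

theory Submission
  imports Defs
begin

text \<open>
  Substituting \<open>u = 16 (w + 4)\<close> turns the \<open>j\<close>-invariant into \<open>256 (w + 1)\<^sup>3 / w\<close>, with \<open>w \<noteq> 0, -4\<close>.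
  The other points \<open>z\<close> of the fibre through \<open>w\<close> are the roots of \<open>w z (w + z + 3) = 1\<close>,
  a quadratic in \<open>z\<close> of discriminant \<open>(w + 1)\<^sup>2 (w + 4) / w\<close>. Hence the fibre has three
  elements if \<open>(w + 4) / w\<close> is a square and \<open>w \<noteq> -1, 1/2\<close>, and one element otherwise.
  The equation \<open>(w + 4) / w = t\<^sup>2\<close> is solved by \<open>w = 4 / (t\<^sup>2 - 1)\<close>, so that \<open>(w + 4) / w\<close> is a
  square for \<open>(q - 3) / 2\<close> values of \<open>w\<close>. Weighting every \<open>w\<close> by the inverse size of its fibre gives
  \<open>3 J = 2 q - 3 + 2 c\<close>, where \<open>c \<le> 2\<close> counts those of \<open>-1, 1/2\<close> for which the square
  condition holds; \<open>c\<close> is then determined by \<open>q\<close> modulo 3.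
\<close>

text \<open>A fibre of n elements carries n weights 1/n, so each value of \<open>f\<close>
  contributes 1.\<close>

lemma card_image_eq_sum_inverse_card_fibre:
  assumes "finite A"
  shows "real (card (f ` A)) = (\<Sum>x\<in>A. 1 / real (card {y \<in> A. f y = f x}))"
proof -
  have "(\<Sum>x\<in>A. 1 / real (card {y \<in> A. f y = f x})) =
      (\<Sum>v\<in>f ` A. \<Sum>x\<in>{x \<in> A. f x = v}. 1 / real (card {y \<in> A. f y = f x}))"
    using assms by (rule sum.image_gen)
  also have "\<dots> = (\<Sum>v\<in>f ` A. 1)"
  proof (rule sum.cong)
    fix v assume "v \<in> f ` A"
    then have "card {y \<in> A. f y = v} \<noteq> 0"
      using assms by auto
    then show "(\<Sum>x\<in>{x \<in> A. f x = v}. 1 / real (card {y \<in> A. f y = f x})) = 1"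
      by simp
  qed simp
  finally show ?thesis by simp
qed

section \<open>Parameters for which \<open>(w + 4) / w\<close> is a square\<close>

definition square_params :: "'a::field set" where
  "square_params = {w. w \<noteq> 0 \<and> w \<noteq> -4 \<and> (\<exists>t. w + 4 = t\<^sup>2 * w)}"

lemma four_neq_zero: "(2::'a::field) \<noteq> 0 \<Longrightarrow> (4::'a) \<noteq> 0"
  by (metis mult_2 mult_eq_0_iff numeral_Bit0)

text \<open>\<open>t = 0\<close> would give the excluded \<open>w = -4\<close>, while
  \<open>t = 1\<close> and \<open>t = -1\<close> make the denominator vanish.\<close>

lemma square_params_eq_image:
  assumes "(2::'a::field) \<noteq> 0"
  shows "(square_params :: 'a set) = (\<lambda>t. 4 / (t\<^sup>2 - 1)) ` (- {0, 1, -1})"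
proof (intro set_eqI iffI)
  fix w :: 'a assume "w \<in> square_params"
  then obtain t where t: "w \<noteq> 0" "w \<noteq> -4" "w + 4 = t\<^sup>2 * w"
    unfolding square_params_def by blast
  then have eq: "w * (t\<^sup>2 - 1) = 4" by algebra
  then have "t\<^sup>2 - 1 \<noteq> 0" using four_neq_zero[OF assms] by auto
  moreover have "t \<noteq> 0" using t by (auto simp: add_eq_0_iff2)
  ultimately have "t \<in> - {0, 1, -1}" "w = 4 / (t\<^sup>2 - 1)"
    using eq by (auto simp: field_simps)
  then show "w \<in> (\<lambda>t. 4 / (t\<^sup>2 - 1)) ` (- {0, 1, -1})" by blast
next
  fix w :: 'a assume "w \<in> (\<lambda>t. 4 / (t\<^sup>2 - 1)) ` (- {0, 1, -1})"
  then obtain t where t: "t \<noteq> 0" "t \<noteq> 1" "t \<noteq> -1" "w = 4 / (t\<^sup>2 - 1)" by blast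
  then have "t\<^sup>2 - 1 \<noteq> 0" by (simp add: power2_eq_1_iff)
  then have eq: "w * (t\<^sup>2 - 1) = 4" unfolding t(4) by (rule nonzero_eq_divide_eq[THEN iffD1]) (rule refl)
  then have "w \<noteq> 0" using four_neq_zero[OF assms] by auto
  moreover have sq: "w + 4 = t\<^sup>2 * w" using eq by (simp add: algebra_simps)
  moreover have "w \<noteq> -4" using sq \<open>w \<noteq> 0\<close> \<open>t \<noteq> 0\<close> by auto
  ultimately show "w \<in> square_params" unfolding square_params_def by blast
qed

text \<open>The parametrisation is two-to-one: it identifies exactly \<open>t\<close> and
  \<open>- t\<close>, which differ for \<open>t \<noteq> 0\<close> because 2 is nonzero.\<close>

lemma card_square_params:
  assumes "(2::'a::{field,finite}) \<noteq> 0"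
  shows "2 * real (card (square_params :: 'a set)) = real CARD('a) - 3"
proof -
  let ?T = "- {0, 1, -1} :: 'a set"
  let ?k = "\<lambda>t::'a. 4 / (t\<^sup>2 - 1)"
  have neq_uminus: "t \<noteq> - t" if "t \<noteq> 0" for t :: 'a
    using assms that by (metis add.right_inverse mult_2 mult_eq_0_iff)
  have fibre: "{y \<in> ?T. ?k y = ?k t} = {t, - t}" if "t \<in> ?T" for t
  proof -
    have "?k y = ?k t \<longleftrightarrow> y = t \<or> y = - t" if "y \<in> ?T" for y
    proof -
      have "y\<^sup>2 - 1 \<noteq> 0" "t\<^sup>2 - 1 \<noteq> 0"
        using that \<open>t \<in> ?T\<close> by (auto simp: power2_eq_1_iff)
      then have "?k y = ?k t \<longleftrightarrow> y\<^sup>2 = t\<^sup>2"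
        using four_neq_zero[OF assms] by (auto simp: frac_eq_eq)
      then show ?thesis by (simp add: power2_eq_iff)
    qed
    moreover have "- t \<in> ?T" using that by (auto simp: minus_equation_iff[of t])
    ultimately show ?thesis using that by auto
  qed
  have "real (card (square_params :: 'a set)) = (\<Sum>t\<in>?T. 1 / real (card {y \<in> ?T. ?k y = ?k t}))"
    unfolding square_params_eq_image[OF assms] by (rule card_image_eq_sum_inverse_card_fibre) simp
  also have "\<dots> = (\<Sum>t\<in>?T. 1 / 2)"
  proof (rule sum.cong)
    fix t assume t: "t \<in> ?T"
    then have "card {t, - t} = 2" using neq_uminus[of t] by simp
    then show "1 / real (card {y \<in> ?T. ?k y = ?k t}) = 1 / 2"
      unfolding fibre[OF t] by simp
  qed simp
  also have "\<dots> = real (card ?T) / 2" by simp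
  also have "real (card ?T) = real CARD('a) - 3"
  proof -
    have "card {0, 1, -1 :: 'a} = 3" using neq_uminus[of 1] by simp
    moreover have "card {0, 1, -1 :: 'a} \<le> CARD('a)" by (rule card_mono) auto
    ultimately show ?thesis by (simp add: Compl_eq_Diff_UNIV card_Diff_subset of_nat_diff)
  qed
  finally show ?thesis by simp
qed

section \<open>Fibres of the cubic map\<close>

definition cubic_ratio :: "'a::field \<Rightarrow> 'a" where
  "cubic_ratio w = (w + 1) ^ 3 / w"

text \<open>After cross-multiplication the difference of the two sides has the factor
  \<open>z - w\<close>; the cofactor gives the second alternative.\<close>

lemma cubic_ratio_eq_iff:
  assumes "w \<noteq> 0" "z \<noteq> 0"
  shows "cubic_ratio z = cubic_ratio w \<longleftrightarrow> z = w \<or> w * z * (w + z + 3) = 1"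
proof -
  have "cubic_ratio z = cubic_ratio w \<longleftrightarrow> (z + 1) ^ 3 * w = (w + 1) ^ 3 * z"
    using assms by (simp add: cubic_ratio_def frac_eq_eq)
  also have "\<dots> \<longleftrightarrow> (z - w) * (w * z * (w + z + 3) - 1) = 0"
    by algebra
  finally show ?thesis by simp
qed

text \<open>The exceptional points have one-element fibres: for \<open>w = -1\<close> the quadratic
  has the double root \<open>-1\<close>, and for \<open>w = 1/2\<close> its roots are
  \<open>1/2\<close> itself and the excluded \<open>-4\<close>.\<close>

lemma card_fibre_cubic_ratio:
  fixes w :: "'a::{field,finite}"
  assumes two: "(2::'a) \<noteq> 0" and w: "w \<noteq> 0" "w \<noteq> -4"
  shows "card {z \<in> - {0, -4}. cubic_ratio z = cubic_ratio w} =
    (if w \<in> square_params - {-1, 1/2} then 3 else 1)"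
proof -
  let ?F = "{z \<in> - {0, -4}. cubic_ratio z = cubic_ratio w}"
  have F: "?F = {z. z \<noteq> 0 \<and> z \<noteq> -4 \<and> (z = w \<or> w * z * (w + z + 3) = 1)}"
    using w by (auto simp: cubic_ratio_eq_iff)
  have half: "w = 1/2 \<longleftrightarrow> 2 * w = 1" using two by (auto simp: field_simps)
  show ?thesis
  proof (cases "w \<in> square_params - {-1, 1/2}")
    case True
    then obtain t where t: "w + 4 = t\<^sup>2 * w"
      unfolding square_params_def by blast
    have w1: "w + 1 \<noteq> 0" using True by (auto simp: add_eq_0_iff2)
    have "w \<noteq> 1/2" using True by blast
    then have w2: "2 * w - 1 \<noteq> 0" unfolding half by simp
    have "t \<noteq> 0" using t w by (auto simp: add_eq_0_iff2)
    \<comment> \<open>The quadratic formula, with \<open>(w + 1) * t\<close> as square root of the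
      discriminant.\<close>
    define z1 where "z1 = (- (w + 3) + (w + 1) * t) / 2"
    define z2 where "z2 = (- (w + 3) - (w + 1) * t) / 2"
    have z1: "2 * z1 = - (w + 3) + (w + 1) * t" and z2: "2 * z2 = - (w + 3) - (w + 1) * t"
      using two by (simp_all add: z1_def z2_def)
    have root_iff: "w * z * (w + z + 3) = 1 \<longleftrightarrow> z = z1 \<or> z = z2" for z
    proof -
      \<comment> \<open>The factor \<open>4 * w\<close> clears the halves and lets \<open>t\<close>
        enter only through \<open>t\<^sup>2 * w\<close>.\<close>
      have "4 * w * (w * z * (w + z + 3) - 1) = w * w * (2 * z - 2 * z1) * (2 * z - 2 * z2)"
        unfolding z1 z2 using t by algebra
      also have "\<dots> = 4 * w * (w * (z - z1) * (z - z2))" by algebra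
      finally have "w * z * (w + z + 3) - 1 = w * (z - z1) * (z - z2)"
        using w four_neq_zero[OF two] by simp
      then show ?thesis using w by auto
    qed
    have neq0: "z \<noteq> 0" if "w * z * (w + z + 3) = 1" for z using that by auto
    have neq4: "z \<noteq> -4" if "w * z * (w + z + 3) = 1" for z
    proof
      assume "z = -4"
      then have "(2 * w - 1) * (2 * w - 1) = 0" using that by algebra
      then show False using w2 by auto
    qed
    have neqw: "z \<noteq> w" if "w * z * (w + z + 3) = 1" for z
    proof
      assume "z = w"
      \<comment> \<open>A point \<open>w\<close> that solves its own quadratic is a zero of this
        cubic, hence \<open>-1\<close> or \<open>1/2\<close>.\<close>
      have "(2 * w - 1) * ((w + 1) * (w + 1)) = w * w * (w + w + 3) - 1" by algebra
      also have "\<dots> = 0" using that unfolding \<open>z = w\<close> by simp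
      finally show False using w1 w2 by auto
    qed
    have "z1 \<noteq> z2"
    proof
      assume "z1 = z2"
      have "2 * ((w + 1) * t) = 2 * z1 - 2 * z2" unfolding z1 z2 by algebra
      also have "\<dots> = 0" using \<open>z1 = z2\<close> by simp
      finally have "2 * ((w + 1) * t) = 0" .
      then show False using two w1 \<open>t \<noteq> 0\<close> by auto
    qed
    moreover have "z1 \<noteq> w" "z2 \<noteq> w" using neqw root_iff by auto
    moreover have "?F = {w, z1, z2}"
      unfolding F using w neq0 neq4 root_iff by auto
    ultimately have "card ?F = 3" by simp
    with True show ?thesis by simp
  next
    case False
    have "z = w" if z: "z \<noteq> -4" "w * z * (w + z + 3) = 1" for z
    proof -
      consider "w = -1" | "2 * w = 1" | "w \<notin> square_params" "w \<noteq> -1"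
        using False half by blast
      then show ?thesis
      proof cases
        case 1
        then have "(z + 1) * (z + 1) = 0" using z by algebra
        then show ?thesis using 1 by (simp add: add_eq_0_iff2)
      next
        case 2
        then have "(2 * z - 1) * (z + 4) = 0" using z by algebra
        then have "2 * z = 2 * w" using z 2 by (auto simp: add_eq_0_iff2)
        then show ?thesis using two by simp
      next
        case 3
        then have w1: "w + 1 \<noteq> 0" by (auto simp: add_eq_0_iff2)
        \<comment> \<open>The quadratic formula solved for \<open>t\<close>: a root \<open>z\<close>
          yields a square root of \<open>(w + 4) / w\<close>.\<close>
        define t where "t = (2 * z + w + 3) / (w + 1)"
        have "(w + 1) * t = 2 * z + w + 3" using w1 by (simp add: t_def)
        then have "(w * (w + 1) * (w + 1)) * (t\<^sup>2 * w - (w + 4)) = 0"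
          using z by algebra
        then have "w + 4 = t\<^sup>2 * w" using w w1 by auto
        then have "w \<in> square_params" using w unfolding square_params_def by blast
        with 3 show ?thesis by simp
      qed
    qed
    then have "?F = {w}" unfolding F using w by auto
    with False show ?thesis by simp
  qed
qed

lemma card_image_cubic_ratio:
  assumes two: "(2::'a::{field,finite}) \<noteq> 0"
  shows "3 * real (card (cubic_ratio ` (- {0, -4 :: 'a}))) =
    2 * real CARD('a) - 3 + 2 * real (card (square_params \<inter> {-1, 1/2 :: 'a}))"
proof -
  let ?W = "- {0, -4} :: 'a set"
  let ?A = "square_params - {-1, 1/2} :: 'a set"
  have sub: "?A \<subseteq> ?W" by (auto simp: square_params_def)
  have "3 * real (card (cubic_ratio ` ?W)) =
      3 * (\<Sum>w\<in>?W. 1 / real (card {z \<in> ?W. cubic_ratio z = cubic_ratio w}))"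
    by (subst card_image_eq_sum_inverse_card_fibre) simp_all
  also have "\<dots> = (\<Sum>w\<in>?W. 3 / real (card {z \<in> ?W. cubic_ratio z = cubic_ratio w}))"
    by (simp add: sum_distrib_left)
  \<comment> \<open>Three times the weight is 1 on \<open>?A\<close> and 3 elsewhere.\<close>
  also have "\<dots> = (\<Sum>w\<in>?W. 3 - 2 * (if w \<in> ?A then 1 else 0))"
  proof (rule sum.cong)
    fix w assume "w \<in> ?W"
    then show "3 / real (card {z \<in> ?W. cubic_ratio z = cubic_ratio w}) =
        3 - 2 * (if w \<in> ?A then 1 else 0)"
      by (subst card_fibre_cubic_ratio[OF two]) auto
  qed simp
  also have "\<dots> = 3 * real (card ?W) - 2 * real (card (?W \<inter> ?A))"
    by (simp only: sum_subtractf sum_distrib_left[symmetric] sum.inter_restrict[symmetric] finite) simp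
  also have "?W \<inter> ?A = ?A" using sub by blast
  also have "real (card ?W) = real CARD('a) - 2"
  proof -
    have "card {0, -4 :: 'a} = 2" using four_neq_zero[OF two] by simp
    moreover have "card {0, -4 :: 'a} \<le> CARD('a)" by (rule card_mono) auto
    ultimately show ?thesis by (simp add: Compl_eq_Diff_UNIV card_Diff_subset of_nat_diff)
  qed
  also have "real (card ?A) = real (card (square_params :: 'a set)) -
      real (card (square_params \<inter> {-1, 1/2 :: 'a}))"
    by (simp add: card_Diff_subset_Int card_mono of_nat_diff)
  finally show ?thesis using card_square_params[OF two] by (simp add: algebra_simps)
qed

section \<open>From the \<open>j\<close>-invariant to the cubic map\<close>

text \<open>The factor \<open>2 ^ 12 * u ^ 3\<close> cancels. At \<open>u = 64\<close> both sides
  are 0, the value of a division by zero.\<close>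

lemma j_invariant_E_D:
  assumes "(2::'a::field) \<noteq> 0" "u \<noteq> 0"
  shows "j_invariant (E_D (u::'a)) = (u - 48) ^ 3 / (u - 64)"
proof -
  have "c4 (E_D u) = 2 ^ 4 * (u * (u - 48))"
    by (simp add: c4_def b2_def b4_def E_D_def power2_eq_square algebra_simps)
  then have "c4 (E_D u) ^ 3 = (2 ^ 12 * u ^ 3) * (u - 48) ^ 3"
    by (simp add: power_mult_distrib)
  then have "j_invariant (E_D u) =
      (2 ^ 12 * u ^ 3) * (u - 48) ^ 3 / ((2 ^ 12 * u ^ 3) * (u - 64))"
    unfolding j_invariant_def discriminant_E_D by (rule arg_cong)
  also have "\<dots> = (u - 48) ^ 3 / (u - 64)"
    by (rule mult_divide_mult_cancel_left) (metis assms mult_eq_0_iff power_not_zero)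
  finally show ?thesis .
qed

text \<open>The substitution sends \<open>w = 0\<close> to \<open>u = 64\<close> and
  \<open>w = -4\<close> to \<open>u = 0\<close>; scaling by the nonzero 256 keeps the number of
  values.\<close>

lemma J_D_eq_card_image_cubic_ratio:
  assumes two: "(2::'a::{field,finite}) \<noteq> 0"
  shows "J_D TYPE('a) = card (cubic_ratio ` (- {0, -4 :: 'a}))"
proof -
  have "(2::'a) ^ 4 \<noteq> 0" "(2::'a) ^ 8 \<noteq> 0"
    using two by (metis power_not_zero)+
  then have nz: "(16::'a) \<noteq> 0" "(256::'a) \<noteq> 0" by simp_all
  have j: "j_invariant (E_D (16 * (w + 4))) = 256 * cubic_ratio w"
    if "w \<noteq> 0" "w \<noteq> -4" for w :: 'a
  proof -
    have "w + 4 \<noteq> 0" using that by (auto simp: add_eq_0_iff2)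
    then have "16 * (w + 4) \<noteq> 0" using nz mult_eq_0_iff by blast
    then have "j_invariant (E_D (16 * (w + 4))) = (16 * (w + 4) - 48) ^ 3 / (16 * (w + 4) - 64)"
      using two j_invariant_E_D by blast
    also have "16 * (w + 4) - 48 = 16 * (w + 1)" by algebra
    also have "16 * (w + 4) - 64 = 16 * w" by algebra
    also have "(16 * (w + 1)) ^ 3 = 16 * (256 * (w + 1) ^ 3)" by algebra
    also have "16 * (256 * (w + 1) ^ 3) / (16 * w) = 256 * cubic_ratio w"
      unfolding cubic_ratio_def times_divide_eq_right
      using nz(1) by (rule mult_divide_mult_cancel_left)
    finally show ?thesis .
  qed
  have params: "{u :: 'a. u \<noteq> 0 \<and> u \<noteq> 64} = (\<lambda>w. 16 * (w + 4)) ` (- {0, -4})"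
  proof (intro set_eqI iffI)
    fix u :: 'a assume u: "u \<in> {u. u \<noteq> 0 \<and> u \<noteq> 64}"
    define w where "w = u / 16 - 4"
    have "u = 16 * (w + 4)" using nz by (simp add: w_def)
    moreover from this have "w \<in> - {0, -4}" using u by auto
    ultimately show "u \<in> (\<lambda>w. 16 * (w + 4)) ` (- {0, -4})" by blast
  next
    fix u :: 'a assume "u \<in> (\<lambda>w. 16 * (w + 4)) ` (- {0, -4})"
    then obtain w where w: "w \<noteq> 0" "w \<noteq> -4" "u = 16 * (w + 4)" by blast
    have "u - 64 = 16 * w" using w(3) by algebra
    then have "u \<noteq> 64" using w nz by auto
    moreover have "w + 4 \<noteq> 0" using w by (auto simp: add_eq_0_iff2)
    then have "u \<noteq> 0" unfolding w(3) using nz mult_eq_0_iff by blast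
    ultimately show "u \<in> {u. u \<noteq> 0 \<and> u \<noteq> 64}" by blast
  qed
  have "{j_invariant (E_D u) | u :: 'a. u \<noteq> 0 \<and> u \<noteq> 64} =
      (\<lambda>u. j_invariant (E_D u)) ` {u. u \<noteq> 0 \<and> u \<noteq> 64}" by blast
  also have "\<dots> = (\<lambda>w. 256 * cubic_ratio w) ` (- {0, -4})"
    unfolding params image_image by (rule image_cong[OF refl], rule j) blast+
  also have "\<dots> = (\<lambda>x. 256 * x) ` cubic_ratio ` (- {0, -4})"
    by (simp add: image_image)
  finally show ?thesis
    unfolding J_D_def using nz by (simp add: card_image inj_on_def)
qed

theorem theorem5:
  fixes q :: nat
  assumes "CHAR('a::{field,finite}) \<ge> 3"
    and "q = CARD('a)"
  shows "real (J_D TYPE('a)) =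
    (if q mod 3 = 0 then (2 * real q - 3) / 3
     else if q mod 3 = 1 then (2 * real q + 1) / 3
     else (2 * real q - 1) / 3)"
proof -
  have "\<not> CHAR('a) dvd 2" using assms(1) by (auto dest: dvd_imp_le)
  then have two: "(2::'a) \<noteq> 0"
    using of_nat_eq_0_iff_char_dvd[of 2, where ?'a = 'a] by simp
  define c where "c = card (square_params \<inter> {-1, 1/2 :: 'a})"
  \<comment> \<open>Only a bound: in characteristic 3 the elements \<open>-1\<close> and
    \<open>1/2\<close> coincide.\<close>
  have "c \<le> card {-1, 1/2 :: 'a}" unfolding c_def by (rule card_mono) auto
  also have "\<dots> \<le> 2" by (simp add: card_insert_if)
  finally have c: "c = 0 \<or> c = 1 \<or> c = 2" by auto
  have J: "3 * real (J_D TYPE('a)) = 2 * real q - 3 + 2 * real c"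
    using card_image_cubic_ratio[OF two] J_D_eq_card_image_cubic_ratio[OF two] assms(2)
    by (simp add: c_def)
  \<comment> \<open>Integrality makes 3 divide \<open>2 * (q + c)\<close>, hence
    \<open>q + c\<close>; as \<open>c \<le> 2\<close>, the residue of \<open>q\<close> fixes
    \<open>c\<close>.\<close>
  then have "3 * J_D TYPE('a) + 3 = 2 * q + 2 * c" by linarith
  then have "(q + c) mod 3 = 0" by presburger
  with c have "q mod 3 = 0 \<and> c = 0 \<or> q mod 3 = 1 \<and> c = 2 \<or> q mod 3 = 2 \<and> c = 1"
    by presburger
  with J show ?thesis by auto
qed

end
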